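(* Let $S$ and $T$ be two weak braces, let $\sigma:T\to\mathrm{Aut}(S)$ be a homomorphism from $(T,\circ)$ into the automorphism group of the weak brace $S$, and write ${}^{u}a:=\sigma(u)(a)$ for all $a\in S$, $u\in T$. Let $\delta:S\to\mathrm{Aut}(T)$ be an anti-homomorphism from $(S,+)$ into the automorphism group of $(T,+)$, and write $u^a:=\delta(a)(u)$ for all $a\in S$, $u\in T$. If the conditions $$(u-u)^a=u-u,$$ $$(u\circ v)^{\lambda_a({}^{u}b)}+u\circ\left((u^-)^b+w\right)=u\circ\left(v^b+w\right)$$ hold for all $a,b\in S$ and $u,v,w\in T$, then $S\times T$ with respect to $$(a,u)+(b,v):=(a+b,\ u^b+v),\qquad (a,u)\circ(b,v):=(a\circ{}^{u}b,\ u\circ v),$$ for all $(a,u),(b,v)\in S\times T$, is a weak brace.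
   Context: A semigroup is inverse if each element $a$ has a unique inverse, i.e. a unique $x$ with $axa=a$ and $xax=x$. A weak (left) brace is a non-empty set $S$ with two binary operations $+$ and $\circ$ such that $(S,+)$ and $(S,\circ)$ are both inverse semigroups (not necessarily commutative) and, for all $a,b,c\in S$, $a\circ(b+c)=a\circ b-a+a\circ c$ and $a\circ a^-=-a+a$, where $-a$ is the inverse of $a$ in $(S,+)$, $a^-$ is the inverse of $a$ in $(S,\circ)$, and $\circ$ has higher precedence than $+$. The automorphism group of a weak brace $S$ consists of the bijections $S\to S$ preserving both $+$ and $\circ$. For $a,b\in S$, $\lambda_a(b)=a\circ(a^-+b)$ (computed in $S$). Automorphisms are composed as functions, so $\delta$ being an anti-homomorphism means $\delta(a+b)=\delta(b)\delta(a)$, i.e. $u^{a+b}=(u^a)^b$. *)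

theory Defs
  imports "HOL-Library.FuncSet"
begin

definition is_sg_inverse :: "'a set \<Rightarrow> ('a \<Rightarrow> 'a \<Rightarrow> 'a) \<Rightarrow> 'a \<Rightarrow> 'a \<Rightarrow> bool" where
  "is_sg_inverse S f a x \<longleftrightarrow> x \<in> S \<and> f (f a x) a = a \<and> f (f x a) x = x"

definition sg_inv :: "'a set \<Rightarrow> ('a \<Rightarrow> 'a \<Rightarrow> 'a) \<Rightarrow> 'a \<Rightarrow> 'a" where
  "sg_inv S f a = (THE x. is_sg_inverse S f a x)"

locale inverse_semigroup =
  fixes S :: "'a set" and f :: "'a \<Rightarrow> 'a \<Rightarrow> 'a"
  assumes closed: "\<lbrakk>a \<in> S; b \<in> S\<rbrakk> \<Longrightarrow> f a b \<in> S"
    and assoc: "\<lbrakk>a \<in> S; b \<in> S; c \<in> S\<rbrakk> \<Longrightarrow> f (f a b) c = f a (f b c)"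
    and unique_inverse: "a \<in> S \<Longrightarrow> \<exists>!x. is_sg_inverse S f a x"

locale weak_brace =
  fixes S :: "'a set" and add :: "'a \<Rightarrow> 'a \<Rightarrow> 'a" and circ :: "'a \<Rightarrow> 'a \<Rightarrow> 'a"
  assumes nonempty: "S \<noteq> {}"
    and inverse_semigroup_add: "inverse_semigroup S add"
    and inverse_semigroup_circ: "inverse_semigroup S circ"
    and circ_add: "\<lbrakk>a \<in> S; b \<in> S; c \<in> S\<rbrakk> \<Longrightarrow>
      circ a (add b c) = add (add (circ a b) (sg_inv S add a)) (circ a c)"
    and circ_inverse: "a \<in> S \<Longrightarrow> circ a (sg_inv S circ a) = add (sg_inv S add a) a"

text \<open>Only the values on the carrier matter: automorphisms are functions on the whole type
  with no requirement outside the carrier, so two of them represent the same automorphism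
  when they agree on the carrier.\<close>

definition semigroup_Aut :: "'a set \<Rightarrow> ('a \<Rightarrow> 'a \<Rightarrow> 'a) \<Rightarrow> ('a \<Rightarrow> 'a) set" where
  "semigroup_Aut S f = {h. bij_betw h S S \<and> (\<forall>a\<in>S. \<forall>b\<in>S. h (f a b) = f (h a) (h b))}"

definition weak_brace_Aut ::
    "'a set \<Rightarrow> ('a \<Rightarrow> 'a \<Rightarrow> 'a) \<Rightarrow> ('a \<Rightarrow> 'a \<Rightarrow> 'a) \<Rightarrow> ('a \<Rightarrow> 'a) set" where
  "weak_brace_Aut S add circ = semigroup_Aut S add \<inter> semigroup_Aut S circ"

definition brace_lambda ::
    "'a set \<Rightarrow> ('a \<Rightarrow> 'a \<Rightarrow> 'a) \<Rightarrow> ('a \<Rightarrow> 'a \<Rightarrow> 'a) \<Rightarrow> 'a \<Rightarrow> 'a \<Rightarrow> 'a" where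
  "brace_lambda S add circ a b = circ a (add (sg_inv S circ a) b)"

end

theory Submission
  imports Defs
begin

text \<open>
  Both operations on \<open>S \<times> T\<close> are semidirect products of inverse semigroups in which one factor acts
  on the other by automorphisms. An idempotent acts by an idempotent bijection, hence trivially.
  Therefore the idempotents of such a product are the pairs of idempotents and multiply
  componentwise, so they commute; since elements also have inverses, the product is an inverse
  semigroup (\<open>inverse_semigroupI\<close>, \<open>inverse_semigroup_semidirect\<close>). In \<open>(S \<times> T, \<circ>)\<close> the factor \<open>T\<close> acts
  from the left, while in \<open>(S \<times> T, +)\<close> the factor \<open>S\<close> acts from the right; exchanging the components
  is an anti-isomorphism that turns the second situation into the first.

  The inverses are \<open>-(a, u) = (-a, (-u)\<^sup>-\<^sup>a)\<close> and \<open>(a, u)\<^sup>- = (\<sigma>(u\<^sup>-)(a\<^sup>-), u\<^sup>-)\<close>. With them the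
  identity \<open>x \<circ> x\<^sup>- = -x + x\<close> holds componentwise, again because idempotents act trivially. In
  \<open>(a, u) \<circ> ((b, v) + (c, w))\<close> the first component is the corresponding identity of \<open>S\<close>. Since
  \<open>\<lambda>\<^sub>a(b) = -a + a \<circ> b\<close>, the second component asks for
  \<open>(u \<circ> v)\<^sup>l + (-u)\<^sup>l + u \<circ> w = u \<circ> (v\<^sup>c + w)\<close> where \<open>l\<close> is \<open>\<lambda>\<^sub>a\<close> of the image of \<open>c\<close> under \<open>\<sigma> u\<close>.
  Comparing with the hypothesis, it remains to see \<open>(-u)\<^sup>l + u \<circ> w = u \<circ> ((u\<^sup>-)\<^sup>c + w)\<close>, and this
  follows from the hypothesis itself at \<open>v = u\<^sup>- \<circ> u\<close> and \<open>v = u\<^sup>-\<close>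
  (\<open>twisted_circ_add\<close>).
\<close>

section \<open>Inverse semigroups\<close>

context inverse_semigroup
begin

lemma is_sg_inverse_sg_inv:
  assumes "a \<in> S"
  shows "is_sg_inverse S f a (sg_inv S f a)"
  unfolding sg_inv_def by (rule theI') (rule unique_inverse[OF assms])

lemma sg_inv_closed: "a \<in> S \<Longrightarrow> sg_inv S f a \<in> S"
  and sg_inv_left: "a \<in> S \<Longrightarrow> f (f a (sg_inv S f a)) a = a"
  and sg_inv_right: "a \<in> S \<Longrightarrow> f (f (sg_inv S f a) a) (sg_inv S f a) = sg_inv S f a"
  using is_sg_inverse_sg_inv unfolding is_sg_inverse_def by blast+

lemma sg_inv_eqI:
  assumes "a \<in> S" "is_sg_inverse S f a x"
  shows "sg_inv S f a = x"
  using unique_inverse[OF assms(1)] is_sg_inverse_sg_inv[OF assms(1)] assms(2) by blast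

lemma sg_inv_sg_inv: "a \<in> S \<Longrightarrow> sg_inv S f (sg_inv S f a) = a"
  by (rule sg_inv_eqI) (simp_all add: is_sg_inverse_def sg_inv_closed sg_inv_left sg_inv_right)

lemma idempotent_sg_inv:
  assumes "a \<in> S"
  shows "f (f a (sg_inv S f a)) (f a (sg_inv S f a)) = f a (sg_inv S f a)"
    and "f (f (sg_inv S f a) a) (f (sg_inv S f a) a) = f (sg_inv S f a) a"
  using assms sg_inv_closed sg_inv_left sg_inv_right closed by (metis assoc)+

text \<open>
  If \<open>x\<close> is the inverse of \<open>ef\<close>, then so is \<open>fxe\<close>, which is idempotent. By uniqueness \<open>x = fxe\<close>, so \<open>x\<close>
  is idempotent and therefore its own inverse; but \<open>ef\<close> is its inverse too.
\<close>

lemma idempotent_closed: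
  assumes "e \<in> S" "g \<in> S" and e: "f e e = e" and g: "f g g = g"
  shows "f (f e g) (f e g) = f e g"
proof -
  define x where "x = sg_inv S f (f e g)"
  have p: "f e g \<in> S" using assms closed by simp
  have x: "x \<in> S" unfolding x_def using p by (rule sg_inv_closed)
  have 1: "f e (f g (f x (f e g))) = f e g"
    using sg_inv_left[OF p] assms(1,2) x unfolding x_def[symmetric] by (simp add: assoc closed)
  have 2: "f x (f e (f g x)) = x"
    using sg_inv_right[OF p] assms(1,2) x unfolding x_def[symmetric] by (simp add: assoc closed)
  have ee: "f e (f e y) = f e y" and gg: "f g (f g y) = f g y" if "y \<in> S" for y
    using that assms by (simp_all add: assoc[symmetric])
  let ?y = "f g (f x e)"
  have 3: "f ?y ?y = ?y"
    using assms(1,2) x 2 by (simp add: assoc closed) (metis assoc closed)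
  have "is_sg_inverse S f (f e g) ?y"
    unfolding is_sg_inverse_def using assms(1,2) x 1 3 by (simp add: assoc closed ee gg)
  then have xy: "x = ?y" unfolding x_def using sg_inv_eqI[OF p] by blast
  then have xx: "f x x = x" using 3 by simp
  have "sg_inv S f x = x"
    using x xx by (intro sg_inv_eqI) (simp_all add: is_sg_inverse_def)
  moreover have "sg_inv S f x = f e g" unfolding x_def using p by (rule sg_inv_sg_inv)
  ultimately show ?thesis using xx by simp
qed

text \<open>Both \<open>ef\<close> and \<open>fe\<close> are idempotent, and then both are inverses of \<open>ef\<close>.\<close>

lemma idempotents_commute:
  assumes "e \<in> S" "g \<in> S" and e: "f e e = e" and g: "f g g = g"
  shows "f e g = f g e"
proof -
  have 1: "f e (f g (f e g)) = f e g" and 2: "f g (f e (f g e)) = f g e"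
    using idempotent_closed[of e g] idempotent_closed[of g e] assms by (simp_all add: assoc closed)
  have ee: "f e (f e y) = f e y" and gg: "f g (f g y) = f g y" if "y \<in> S" for y
    using that assms by (simp_all add: assoc[symmetric])
  have "is_sg_inverse S f (f e g) (f e g)"
    unfolding is_sg_inverse_def using assms(1,2) 1 by (simp add: assoc closed)
  moreover have "is_sg_inverse S f (f e g) (f g e)"
    unfolding is_sg_inverse_def using assms(1,2) 1 2 by (simp add: assoc closed ee gg)
  ultimately show ?thesis using unique_inverse[of "f e g"] assms closed by blast
qed

end

text \<open>
  If \<open>x\<close> and \<open>y\<close> are inverses of \<open>a\<close>, then commuting the idempotents \<open>xa, ya\<close> gives \<open>x = yax\<close>, and
  commuting \<open>ax, ay\<close> gives \<open>y = yax\<close>.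
\<close>

lemma inverse_semigroupI:
  assumes closed: "\<And>a b. \<lbrakk>a \<in> S; b \<in> S\<rbrakk> \<Longrightarrow> f a b \<in> S"
    and assoc: "\<And>a b c. \<lbrakk>a \<in> S; b \<in> S; c \<in> S\<rbrakk> \<Longrightarrow> f (f a b) c = f a (f b c)"
    and regular: "\<And>a. a \<in> S \<Longrightarrow> \<exists>x. is_sg_inverse S f a x"
    and commute: "\<And>e g. \<lbrakk>e \<in> S; g \<in> S; f e e = e; f g g = g\<rbrakk> \<Longrightarrow> f e g = f g e"
  shows "inverse_semigroup S f"
proof
  fix a assume a: "a \<in> S"
  have "x = y" if "is_sg_inverse S f a x" "is_sg_inverse S f a y" for x y
  proof -
    from that have x: "x \<in> S" "f a (f x a) = a" "f x (f a x) = x"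
      and y: "y \<in> S" "f a (f y a) = a" "f y (f a y) = y"
      unfolding is_sg_inverse_def using a by (auto simp: assoc closed)
    have "x = f (f x a) (f (f y a) x)"
      using a x y by (metis assoc closed)
    also have "\<dots> = f (f (f x a) (f y a)) x"
      using a x(1) y(1) by (simp add: assoc closed)
    also have "f (f x a) (f y a) = f (f y a) (f x a)"
      using a x y by (intro commute) (simp_all add: assoc closed)
    also have "f (f (f y a) (f x a)) x = f y (f a x)"
      using a x y by (simp add: assoc closed)
    finally have 1: "x = f y (f a x)" .
    have "y = f y (f (f a x) (f a y))"
      using a x y by (metis assoc closed)
    also have "f (f a x) (f a y) = f (f a y) (f a x)"
      using a x y by (intro commute) (simp_all add: assoc closed)
    also have "f y (f (f a y) (f a x)) = f y (f a x)"
      using a x y by (metis assoc closed)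
    finally show ?thesis using 1 by simp
  qed
  then show "\<exists>!x. is_sg_inverse S f a x" using regular[OF a] by blast
qed (use closed assoc in auto)

text \<open>The conditions defining an inverse are unchanged when the order of all products is reversed.\<close>

lemma is_sg_inverse_anti_hom:
  assumes "inverse_semigroup A f" "a \<in> A" "is_sg_inverse A f a x" "h ` A \<subseteq> B"
    and "\<And>a b. \<lbrakk>a \<in> A; b \<in> A\<rbrakk> \<Longrightarrow> h (f a b) = g (h b) (h a)"
    and "\<And>a b c. \<lbrakk>a \<in> B; b \<in> B; c \<in> B\<rbrakk> \<Longrightarrow> g (g a b) c = g a (g b c)"
  shows "is_sg_inverse B g (h a) (h x)"
proof -
  interpret inverse_semigroup A f by fact
  from assms(3) have x: "x \<in> A" "f (f a x) a = a" "f (f x a) x = x"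
    unfolding is_sg_inverse_def by auto
  have B: "h a \<in> B" "h x \<in> B" using assms(2,4) x(1) by auto
  have "g (h a) (g (h x) (h a)) = h a" "g (h x) (g (h a) (h x)) = h x"
    using assms(2,5) x closed by metis+
  then show ?thesis unfolding is_sg_inverse_def using B assms(6) by auto
qed

lemma inverse_semigroup_anti_iso:
  assumes "inverse_semigroup A f" and h: "bij_betw h A B"
    and hom: "\<And>a b. \<lbrakk>a \<in> A; b \<in> A\<rbrakk> \<Longrightarrow> h (f a b) = g (h b) (h a)"
  shows "inverse_semigroup B g"
proof -
  interpret inverse_semigroup A f by fact
  have B: "B = h ` A" using h by (simp add: bij_betw_def)
  have inj: "h a = h b \<longleftrightarrow> a = b" if "a \<in> A" "b \<in> A" for a b
    using h that by (auto simp: bij_betw_def inj_on_def)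
  have gassoc: "g (g a b) c = g a (g b c)" if "a \<in> B" "b \<in> B" "c \<in> B" for a b c
    using that unfolding B by (auto simp: hom[symmetric] closed assoc)
  show ?thesis
  proof (rule inverse_semigroupI)
    fix b assume "b \<in> B"
    then obtain a where a: "a \<in> A" "b = h a" unfolding B by auto
    show "\<exists>y. is_sg_inverse B g b y"
      unfolding a(2)
      using is_sg_inverse_anti_hom[where h = h and g = g, OF assms(1) a(1) is_sg_inverse_sg_inv[OF a(1)] _ hom gassoc] B
      by blast
  next
    fix e k assume "e \<in> B" "k \<in> B" "g e e = e" "g k k = k"
    then show "g e k = g k e"
      unfolding B by (auto simp: hom[symmetric] closed inj intro: idempotents_commute[symmetric])
  qed (use gassoc in \<open>auto simp: B hom[symmetric] closed\<close>)
qed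

section \<open>Semidirect products\<close>

lemma semigroup_AutD:
  assumes "h \<in> semigroup_Aut S f"
  shows "a \<in> S \<Longrightarrow> h a \<in> S"
    and "\<lbrakk>a \<in> S; b \<in> S\<rbrakk> \<Longrightarrow> h (f a b) = f (h a) (h b)"
    and "\<lbrakk>a \<in> S; b \<in> S\<rbrakk> \<Longrightarrow> h a = h b \<longleftrightarrow> a = b"
  using assms unfolding semigroup_Aut_def by (auto simp: bij_betw_def inj_on_def)

locale semigroup_action =
  A: inverse_semigroup A f + B: inverse_semigroup B g
  for A :: "'a set" and f and B :: "'b set" and g +
  fixes \<sigma> :: "'b \<Rightarrow> 'a \<Rightarrow> 'a"
  assumes action_Aut: "u \<in> B \<Longrightarrow> \<sigma> u \<in> semigroup_Aut A f"
    and action_mult: "\<lbrakk>u \<in> B; v \<in> B; a \<in> A\<rbrakk> \<Longrightarrow> \<sigma> (g u v) a = \<sigma> u (\<sigma> v a)"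
begin

lemmas action_closed = semigroup_AutD(1)[OF action_Aut]
  and action_hom = semigroup_AutD(2)[OF action_Aut]
  and action_inj = semigroup_AutD(3)[OF action_Aut]

text \<open>Here \<open>\<sigma> u\<close> is injective and \<open>\<sigma> u (\<sigma> u a) = \<sigma> u a\<close>.\<close>

lemma idempotent_acts_trivially:
  assumes "u \<in> B" "g u u = u" "a \<in> A"
  shows "\<sigma> u a = a"
  using assms action_mult[of u u a] action_inj action_closed by metis

definition semidirect :: "'a \<times> 'b \<Rightarrow> 'a \<times> 'b \<Rightarrow> 'a \<times> 'b" where
  "semidirect = (\<lambda>(a, u) (b, v). (f a (\<sigma> u b), g u v))"

definition semidirect_inv :: "'a \<times> 'b \<Rightarrow> 'a \<times> 'b" where
  "semidirect_inv = (\<lambda>(a, u). (\<sigma> (sg_inv B g u) (sg_inv A f a), sg_inv B g u))"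

text \<open>\<open>\<sigma> u\<close> and \<open>\<sigma> u\<^sup>-\<close> are inverse to each other, since \<open>u u\<^sup>-\<close> and \<open>u\<^sup>- u\<close> are idempotent.\<close>

lemma is_sg_inverse_semidirect:
  assumes "x \<in> A \<times> B"
  shows "is_sg_inverse (A \<times> B) semidirect x (semidirect_inv x)"
proof -
  obtain a u where x: "x = (a, u)" and a: "a \<in> A" and u: "u \<in> B" using assms by auto
  let ?a = "sg_inv A f a" and ?u = "sg_inv B g u"
  have a': "?a \<in> A" and u': "?u \<in> B" using a u A.sg_inv_closed B.sg_inv_closed by auto
  have "\<sigma> u (\<sigma> ?u b) = b" "\<sigma> ?u (\<sigma> u b) = b" if "b \<in> A" for b
    using that u u' B.idempotent_sg_inv[OF u] B.closed
    by (simp_all add: action_mult[symmetric] idempotent_acts_trivially)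
  then show ?thesis
    unfolding is_sg_inverse_def semidirect_def semidirect_inv_def x
    using a u a' u' A.sg_inv_left[OF a] A.sg_inv_right[OF a]
      B.sg_inv_left[OF u] B.sg_inv_right[OF u]
    by (auto simp: action_mult action_closed B.closed action_hom[symmetric] A.closed)
qed

lemma inverse_semigroup_semidirect: "inverse_semigroup (A \<times> B) semidirect"
proof (rule inverse_semigroupI)
  fix x assume "x \<in> A \<times> B"
  then show "\<exists>y. is_sg_inverse (A \<times> B) semidirect x y" using is_sg_inverse_semidirect by blast
next
  fix x y assume xy: "x \<in> A \<times> B" "y \<in> A \<times> B" "semidirect x x = x" "semidirect y y = y"
  then show "semidirect x y = semidirect y x"
    unfolding semidirect_def
    by (auto simp: idempotent_acts_trivially
        intro: A.idempotents_commute B.idempotents_commute)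
qed (auto simp: semidirect_def A.closed B.closed A.assoc B.assoc action_closed action_hom action_mult)

end

text \<open>
  A right action of \<open>A\<close> on \<open>B\<close> is a left action of the opposite of \<open>A\<close> on the opposite of \<open>B\<close>, and the
  exchange of components is an anti-isomorphism between the two semidirect products.
\<close>

lemma
  assumes A: "inverse_semigroup A f" and B: "inverse_semigroup B g"
    and Aut: "\<And>a. a \<in> A \<Longrightarrow> \<delta> a \<in> semigroup_Aut B g"
    and anti: "\<And>a b u. \<lbrakk>a \<in> A; b \<in> A; u \<in> B\<rbrakk> \<Longrightarrow> \<delta> (f a b) u = \<delta> b (\<delta> a u)"
  defines "h \<equiv> \<lambda>(a, u) (b, v). (f a b, g (\<delta> b u) v)"
  shows inverse_semigroup_right_semidirect: "inverse_semigroup (A \<times> B) h"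
    and sg_inv_right_semidirect: "\<lbrakk>a \<in> A; u \<in> B\<rbrakk> \<Longrightarrow>
      sg_inv (A \<times> B) h (a, u) = (sg_inv A f a, \<delta> (sg_inv A f a) (sg_inv B g u))"
    and right_action_idempotent: "\<lbrakk>a \<in> A; u \<in> B; f a a = a\<rbrakk> \<Longrightarrow> \<delta> a u = u"
proof -
  let ?f = "\<lambda>a b. f b a" and ?g = "\<lambda>u v. g v u"
  have A': "inverse_semigroup A ?f" and B': "inverse_semigroup B ?g"
    using inverse_semigroup_anti_iso[OF A bij_betw_id, of ?f]
      inverse_semigroup_anti_iso[OF B bij_betw_id, of ?g] by simp_all
  interpret op: semigroup_action B ?g A ?f \<delta>
    using Aut anti
    by (intro semigroup_action.intro A' B' semigroup_action_axioms.intro)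
      (auto simp: semigroup_Aut_def)
  have swap: "bij_betw prod.swap (B \<times> A) (A \<times> B)"
    by (auto simp: bij_betw_def product_swap)
  have hom: "prod.swap (op.semidirect x y) = h (prod.swap y) (prod.swap x)" for x y
    by (cases x; cases y) (simp add: op.semidirect_def h_def)
  show h: "inverse_semigroup (A \<times> B) h"
    using inverse_semigroup_anti_iso[where h = prod.swap and g = h, OF op.inverse_semigroup_semidirect swap]
      hom by blast
  show "sg_inv (A \<times> B) h (a, u) = (sg_inv A f a, \<delta> (sg_inv A f a) (sg_inv B g u))"
    if "a \<in> A" "u \<in> B"
  proof -
    interpret A: inverse_semigroup A f by fact
    interpret B: inverse_semigroup B g by fact
    interpret h: inverse_semigroup "A \<times> B" h by (rule h)
    have "sg_inv A ?f a = sg_inv A f a" "sg_inv B ?g u = sg_inv B g u"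
      using that A.is_sg_inverse_sg_inv[of a] B.is_sg_inverse_sg_inv[of u]
      by (auto intro!: op.A.sg_inv_eqI op.B.sg_inv_eqI simp: is_sg_inverse_def A.assoc B.assoc)
    then have inv: "prod.swap (op.semidirect_inv (u, a))
        = (sg_inv A f a, \<delta> (sg_inv A f a) (sg_inv B g u))"
      by (simp add: op.semidirect_inv_def)
    have "is_sg_inverse (A \<times> B) h (prod.swap (u, a)) (prod.swap (op.semidirect_inv (u, a)))"
      using that
      by (intro is_sg_inverse_anti_hom[where h = prod.swap and g = h, OF op.inverse_semigroup_semidirect _
            op.is_sg_inverse_semidirect _ hom h.assoc]) auto
    then show ?thesis using that unfolding inv by (intro h.sg_inv_eqI) auto
  qed
  show "\<delta> a u = u" if "a \<in> A" "u \<in> B" "f a a = a"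
    using op.idempotent_acts_trivially that by simp
qed

section \<open>Weak braces\<close>

context weak_brace
begin

sublocale add: inverse_semigroup S add by (rule inverse_semigroup_add)
sublocale circ: inverse_semigroup S circ by (rule inverse_semigroup_circ)

text \<open>Expand \<open>a \<circ> (a\<^sup>- + b) = a \<circ> a\<^sup>- - a + a \<circ> b = (-a + a) - a + a \<circ> b\<close>.\<close>

lemma brace_lambda_eq:
  assumes "a \<in> S" "b \<in> S"
  shows "brace_lambda S add circ a b = add (sg_inv S add a) (circ a b)"
  using assms
  by (simp add: brace_lambda_def circ_add circ_inverse circ.sg_inv_closed add.sg_inv_closed
      add.sg_inv_right)

text \<open>
  In the notation of the introduction, \<open>h\<close> and \<open>k\<close> are the actions of \<open>l\<close> and of \<open>c\<close>. Taking
  \<open>v = u\<^sup>- \<circ> u\<close> in the hypothesis \<open>twist\<close> yields \<open>h u + X = u - u + u \<circ> w\<close> with \<open>X = u \<circ> (k u\<^sup>- + w)\<close>,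
  because \<open>v\<close> is an additive idempotent and so is fixed by \<open>k\<close>. Taking \<open>v = u\<^sup>-\<close> shows that \<open>X\<close> absorbs
  \<open>-u + u\<close> from the left. Hence adding \<open>h (-u)\<close> to the first equation gives \<open>X = h (-u) + u \<circ> w\<close>.
\<close>

lemma twisted_circ_add:
  assumes h: "h \<in> semigroup_Aut S add" and k: "k \<in> semigroup_Aut S add"
    and h_fix: "\<And>u. u \<in> S \<Longrightarrow> h (add u (sg_inv S add u)) = add u (sg_inv S add u)"
    and k_fix: "\<And>u. u \<in> S \<Longrightarrow> k (add u (sg_inv S add u)) = add u (sg_inv S add u)"
    and twist: "\<And>v w. \<lbrakk>v \<in> S; w \<in> S\<rbrakk> \<Longrightarrow>
      add (h (circ u v)) (circ u (add (k (sg_inv S circ u)) w)) = circ u (add (k v) w)"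
    and u: "u \<in> S" and v: "v \<in> S" and w: "w \<in> S"
  shows "add (h (circ u v)) (add (h (sg_inv S add u)) (circ u w)) = circ u (add (k v) w)"
proof -
  note [simp] = add.closed circ.closed add.sg_inv_closed circ.sg_inv_closed
    semigroup_AutD(1)[OF h] semigroup_AutD(1)[OF k]
  let ?m = "sg_inv S add u" and ?i = "sg_inv S circ u"
  let ?X = "circ u (add (k ?i) w)"
  have fix': "h (add (sg_inv S add x) x) = add (sg_inv S add x) x"
    "k (add (sg_inv S add x) x) = add (sg_inv S add x) x" if "x \<in> S" for x
    using h_fix[of "sg_inv S add x"] k_fix[of "sg_inv S add x"] that
    by (simp_all add: add.sg_inv_sg_inv)
  have uiu: "circ u (circ ?i u) = u" using u circ.sg_inv_left[OF u] by (simp add: circ.assoc)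
  \<comment> \<open>\<open>u\<^sup>- \<circ> u = u\<^sup>- \<circ> (u\<^sup>-)\<^sup>-\<close> is of the form \<open>-x + x\<close> with \<open>x = u\<^sup>-\<close>.\<close>
  have "circ ?i u = add (sg_inv S add ?i) ?i"
    using circ_inverse[of ?i] u by (simp add: circ.sg_inv_sg_inv)
  then have "k (circ ?i u) = circ ?i u" using fix' u by simp
  then have 1: "add (h u) ?X = add (add u ?m) (circ u w)"
    using twist[of "circ ?i u" w] u w by (simp add: uiu circ_add)
  have 2: "add (add ?m u) ?X = ?X"
    using twist[of ?i w] u w by (simp add: circ_inverse fix')
  have "?X = add (h (add ?m u)) ?X" using 2 u by (simp add: fix')
  also have "\<dots> = add (h ?m) (add (h u) ?X)"
    using u w by (simp add: semigroup_AutD(2)[OF h] add.assoc)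
  also have "\<dots> = add (add (h ?m) (h (add u ?m))) (circ u w)"
    unfolding 1 using u w by (simp add: h_fix add.assoc)
  also have "add (h ?m) (h (add u ?m)) = h ?m"
    using u add.sg_inv_right[OF u] by (simp add: semigroup_AutD(2)[OF h, symmetric] add.assoc)
  finally have X: "?X = add (h ?m) (circ u w)" .
  show ?thesis using twist[OF v w] unfolding X .
qed

end

theorem theorem23:
  fixes S :: "'a set" and T :: "'b set"
    and addS :: "'a \<Rightarrow> 'a \<Rightarrow> 'a" (infixl "+\<^sub>S" 65)
    and circS :: "'a \<Rightarrow> 'a \<Rightarrow> 'a" (infixl "\<circ>\<^sub>S" 70)
    and addT :: "'b \<Rightarrow> 'b \<Rightarrow> 'b" (infixl "+\<^sub>T" 65)
    and circT :: "'b \<Rightarrow> 'b \<Rightarrow> 'b" (infixl "\<circ>\<^sub>T" 70)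
    and \<sigma> :: "'b \<Rightarrow> 'a \<Rightarrow> 'a" and \<delta> :: "'a \<Rightarrow> 'b \<Rightarrow> 'b"
  assumes "weak_brace S (+\<^sub>S) (\<circ>\<^sub>S)" and "weak_brace T (+\<^sub>T) (\<circ>\<^sub>T)"
    and "\<sigma> \<in> T \<rightarrow> weak_brace_Aut S (+\<^sub>S) (\<circ>\<^sub>S)"
    and "\<And>u v a. \<lbrakk>u \<in> T; v \<in> T; a \<in> S\<rbrakk> \<Longrightarrow> \<sigma> (u \<circ>\<^sub>T v) a = (\<sigma> u \<circ> \<sigma> v) a"
    and "\<delta> \<in> S \<rightarrow> semigroup_Aut T (+\<^sub>T)"
    and "\<And>a b u. \<lbrakk>a \<in> S; b \<in> S; u \<in> T\<rbrakk> \<Longrightarrow> \<delta> (a +\<^sub>S b) u = (\<delta> b \<circ> \<delta> a) u"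
    and "\<And>a u. \<lbrakk>a \<in> S; u \<in> T\<rbrakk> \<Longrightarrow>
      \<delta> a (u +\<^sub>T sg_inv T (+\<^sub>T) u) = u +\<^sub>T sg_inv T (+\<^sub>T) u"
    and "\<And>a b u v w. \<lbrakk>a \<in> S; b \<in> S; u \<in> T; v \<in> T; w \<in> T\<rbrakk> \<Longrightarrow>
      \<delta> (brace_lambda S (+\<^sub>S) (\<circ>\<^sub>S) a (\<sigma> u b)) (u \<circ>\<^sub>T v)
        +\<^sub>T u \<circ>\<^sub>T (\<delta> b (sg_inv T (\<circ>\<^sub>T) u) +\<^sub>T w)
      = u \<circ>\<^sub>T (\<delta> b v +\<^sub>T w)"
  shows "weak_brace (S \<times> T)
    (\<lambda>(a, u) (b, v). (a +\<^sub>S b, \<delta> b u +\<^sub>T v))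
    (\<lambda>(a, u) (b, v). (a \<circ>\<^sub>S \<sigma> u b, u \<circ>\<^sub>T v))"
proof -
  interpret S: weak_brace S "(+\<^sub>S)" "(\<circ>\<^sub>S)" by (rule assms(1))
  interpret T: weak_brace T "(+\<^sub>T)" "(\<circ>\<^sub>T)" by (rule assms(2))
  have \<sigma>_add: "\<sigma> u \<in> semigroup_Aut S (+\<^sub>S)" and \<sigma>_circ: "\<sigma> u \<in> semigroup_Aut S (\<circ>\<^sub>S)"
    if "u \<in> T" for u
    using assms(3) that by (auto simp: weak_brace_Aut_def)
  have \<delta>_add: "\<delta> a \<in> semigroup_Aut T (+\<^sub>T)" if "a \<in> S" for a using assms(5) that by auto
  have \<delta>_anti: "\<delta> (a +\<^sub>S b) u = \<delta> b (\<delta> a u)" if "a \<in> S" "b \<in> S" "u \<in> T" for a b u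
    using assms(6) that by simp
  interpret act: semigroup_action S "(\<circ>\<^sub>S)" T "(\<circ>\<^sub>T)" \<sigma>
    using assms(4) \<sigma>_circ by unfold_locales auto
  note [simp] = S.add.closed S.circ.closed S.add.sg_inv_closed S.circ.sg_inv_closed
    T.add.closed T.circ.closed T.add.sg_inv_closed T.circ.sg_inv_closed
    semigroup_AutD(1)[OF \<sigma>_add] semigroup_AutD(1)[OF \<delta>_add]
  define add where "add = (\<lambda>(a, u) (b, v). (a +\<^sub>S b, \<delta> b u +\<^sub>T v))"
  note right = S.inverse_semigroup_add T.inverse_semigroup_add \<delta>_add \<delta>_anti
  have inv_add: "inverse_semigroup (S \<times> T) add"
    unfolding add_def by (rule inverse_semigroup_right_semidirect[where \<delta> = \<delta>, OF right])
  have add_inv: "sg_inv (S \<times> T) add (a, u)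
      = (sg_inv S (+\<^sub>S) a, \<delta> (sg_inv S (+\<^sub>S) a) (sg_inv T (+\<^sub>T) u))"
    if "a \<in> S" "u \<in> T" for a u
    unfolding add_def using that by (intro sg_inv_right_semidirect[where \<delta> = \<delta>, OF right])
  interpret C: inverse_semigroup "S \<times> T" act.semidirect by (rule act.inverse_semigroup_semidirect)
  have "weak_brace (S \<times> T) add act.semidirect"
  proof (rule weak_brace.intro)
    show "S \<times> T \<noteq> {}" using S.nonempty T.nonempty by simp
    show "inverse_semigroup (S \<times> T) add" by (rule inv_add)
    show "inverse_semigroup (S \<times> T) act.semidirect" by (rule act.inverse_semigroup_semidirect)
  next
    fix x y z assume "x \<in> S \<times> T" "y \<in> S \<times> T" "z \<in> S \<times> T"
    then obtain a u b v c w where xyz: "x = (a, u)" "y = (b, v)" "z = (c, w)"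
      and [simp]: "a \<in> S" "b \<in> S" "c \<in> S" "u \<in> T" "v \<in> T" "w \<in> T" by auto
    let ?a = "sg_inv S (+\<^sub>S) a" and ?u = "sg_inv T (+\<^sub>T) u"
    let ?l = "brace_lambda S (+\<^sub>S) (\<circ>\<^sub>S) a (\<sigma> u c)"
    have l: "?l = ?a +\<^sub>S a \<circ>\<^sub>S \<sigma> u c" by (simp add: S.brace_lambda_eq)
    then have [simp]: "?l \<in> S" by simp
    have "a \<circ>\<^sub>S \<sigma> u (b +\<^sub>S c) = (a \<circ>\<^sub>S \<sigma> u b +\<^sub>S ?a) +\<^sub>S a \<circ>\<^sub>S \<sigma> u c"
      by (simp add: semigroup_AutD(2)[OF \<sigma>_add] S.circ_add)
    moreover have "u \<circ>\<^sub>T (\<delta> c v +\<^sub>T w)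
        = \<delta> (a \<circ>\<^sub>S \<sigma> u c) (\<delta> ?a (u \<circ>\<^sub>T v) +\<^sub>T \<delta> ?a ?u) +\<^sub>T u \<circ>\<^sub>T w"
    proof -
      have "u \<circ>\<^sub>T (\<delta> c v +\<^sub>T w) = \<delta> ?l (u \<circ>\<^sub>T v) +\<^sub>T (\<delta> ?l ?u +\<^sub>T u \<circ>\<^sub>T w)"
        by (rule T.twisted_circ_add[symmetric]) (simp_all add: \<delta>_add assms(7,8))
      also have "\<dots> = (\<delta> ?l (u \<circ>\<^sub>T v) +\<^sub>T \<delta> ?l ?u) +\<^sub>T u \<circ>\<^sub>T w"
        by (simp add: T.add.assoc)
      \<comment> \<open>Acting by \<open>?l = -a + a \<circ> \<sigma> u c\<close> is acting by \<open>-a\<close> first and by \<open>a \<circ> \<sigma> u c\<close> after it.\<close>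
      finally show ?thesis
        by (simp add: l \<delta>_anti semigroup_AutD(2)[OF \<delta>_add])
    qed
    ultimately show "act.semidirect x (add y z)
        = add (add (act.semidirect x y) (sg_inv (S \<times> T) add x)) (act.semidirect x z)"
      by (simp add: xyz add_inv) (simp add: act.semidirect_def add_def)
  next
    fix x assume "x \<in> S \<times> T"
    then obtain a u where x: "x = (a, u)" and [simp]: "a \<in> S" "u \<in> T" by auto
    have 1: "sg_inv (S \<times> T) act.semidirect (a, u) = act.semidirect_inv (a, u)"
      by (intro C.sg_inv_eqI act.is_sg_inverse_semidirect) simp_all
    have "\<sigma> u (\<sigma> (sg_inv T (\<circ>\<^sub>T) u) b) = b" if "b \<in> S" for b
      using that
      by (simp add: act.action_mult[symmetric] act.idempotent_acts_trivially
          T.circ.idempotent_sg_inv)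
    moreover have "\<delta> a (\<delta> (sg_inv S (+\<^sub>S) a) v) = v" if "v \<in> T" for v
      using that right_action_idempotent[where \<delta> = \<delta> and u = v, OF right]
      by (simp add: \<delta>_anti[symmetric] S.add.idempotent_sg_inv)
    ultimately show "act.semidirect x (sg_inv (S \<times> T) act.semidirect x)
        = add (sg_inv (S \<times> T) add x) x"
      by (simp add: x 1 add_inv act.semidirect_inv_def)
        (simp add: act.semidirect_def add_def S.circ_inverse T.circ_inverse)
  qed
  then show ?thesis unfolding add_def act.semidirect_def .
qed

end
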